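(* Let $G$ be a tree of order $n\ge 2$ and let $k$ be an integer with $1\leq k\leq n-1$. Then $$\kappa(F_k(G))=\lambda(F_k(G))=\delta(F_k(G)),$$ where $F_k(G)$ is the $k$-token graph of $G$.
   Context: All graphs are simple and finite. For a graph $G$ of order $n\ge 2$ and $k\in\{1,\ldots,n-1\}$, the $k$-token graph $F_k(G)$ of $G$ is the graph whose vertices are all the $k$-subsets of $V(G)$, where two $k$-subsets $A,B$ are adjacent whenever their symmetric difference $A\triangle B$ is a pair $\{a,b\}$ of adjacent vertices of $G$. For a graph $H$, $\kappa(H)$, $\lambda(H)$ and $\delta(H)$ denote respectively the (vertex) connectivity, the edge-connectivity and the minimum degree of $H$ (with the usual convention $\kappa(K_m)=m-1$ for complete graphs). *)

theory Defs
  imports "Graph_Theory.Graph_Theory"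
begin

text \<open>
  Finite simple graphs are instances of \<^locale>\<open>pair_graph\<close>: an undirected edge between
  \<open>u\<close> and \<open>v\<close> is represented by the two arcs \<open>(u, v)\<close> and \<open>(v, u)\<close>.

  The library's \<^const>\<open>tree\<close> cannot be used for such graphs, since its cycles include
  the closed walks \<open>u, v, u\<close> of length two, so that no graph with an edge would be a tree.
  Cycles of an undirected graph have length at least three.
\<close>

definition undirected_tree :: "'a pair_pre_digraph \<Rightarrow> bool" where
  "undirected_tree G \<longleftrightarrow> pair_graph G \<and> connected (with_proj G) \<and>
     \<not> (\<exists>p. pre_digraph.cycle (with_proj G) p \<and> 3 \<le> length p)"

definition token_graph :: "nat \<Rightarrow> 'a pair_pre_digraph \<Rightarrow> 'a set pair_pre_digraph" where
  "token_graph k G =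
     \<lparr> pverts = {A. A \<subseteq> pverts G \<and> card A = k},
       parcs = {(A, B). A \<subseteq> pverts G \<and> card A = k \<and> B \<subseteq> pverts G \<and> card B = k \<and>
                  (\<exists>(a, b) \<in> parcs G. sym_diff A B = {a, b})} \<rparr>"

lemma pair_graph_token_graph:
  assumes "pair_graph G"
  shows "pair_graph (token_graph k G)"
proof -
  interpret pair_graph G by fact
  have arcs: "parcs (token_graph k G) \<subseteq> pverts (token_graph k G) \<times> pverts (token_graph k G)"
    unfolding token_graph_def by auto
  have fin: "finite (pverts (token_graph k G))"
    unfolding token_graph_def using pair_finite_verts by simp
  have fin_arcs: "finite (parcs (token_graph k G))"
    by (rule finite_subset[OF arcs]) (intro finite_cartesian_product fin)
  have irrefl: "A \<noteq> B" if "(A, B) \<in> parcs (token_graph k G)" for A B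
  proof
    assume "A = B"
    moreover obtain a b where "sym_diff A B = {a, b}"
      using \<open>(A, B) \<in> parcs (token_graph k G)\<close> unfolding token_graph_def by force
    ultimately show False
      by simp
  qed
  have "sym (parcs (token_graph k G))"
    unfolding sym_def token_graph_def by (simp add: Un_commute)
  then have sym: "symmetric (with_proj (token_graph k G))"
    by (simp add: symmetric_def)
  show ?thesis
  proof
    show "symmetric (with_proj (token_graph k G))"
      by (rule sym)
  next
    show "fst e \<noteq> snd e" if "e \<in> parcs (token_graph k G)" for e
      using irrefl[of "fst e" "snd e"] that by simp
  qed (use arcs fin fin_arcs in auto)
qed

text \<open>The degree of a vertex is its out-degree, since each incident edge leaves it exactly once.\<close>

definition min_degree :: "'a pair_pre_digraph \<Rightarrow> nat" where
  "min_degree H = Min (out_degree (with_proj H) ` pverts H)"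

text \<open>
  The library's \<^const>\<open>connected\<close> is false for the graph without vertices, hence only
  proper subsets of the vertex set are deleted here.
\<close>

definition vertex_connectivity :: "'a pair_pre_digraph \<Rightarrow> nat" where
  "vertex_connectivity H =
     (if complete_digraph (card (pverts H)) (with_proj H) then card (pverts H) - 1
      else Min {card S |S. S \<subset> pverts H \<and>
                  \<not> connected (induce_subgraph (with_proj H) (pverts H - S))})"

definition undirected_edges :: "'a pair_pre_digraph \<Rightarrow> 'a set set" where
  "undirected_edges H = {{u, v} |u v. (u, v) \<in> parcs H}"

definition delete_edges :: "'a pair_pre_digraph \<Rightarrow> 'a set set \<Rightarrow> 'a pair_pre_digraph" where
  "delete_edges H F = \<lparr> pverts = pverts H, parcs = {(u, v) \<in> parcs H. {u, v} \<notin> F} \<rparr>"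

text \<open>A graph with at most one vertex has no disconnecting edge set; its edge-connectivity is 0.\<close>

definition edge_connectivity :: "'a pair_pre_digraph \<Rightarrow> nat" where
  "edge_connectivity H =
     (if card (pverts H) \<le> 1 then 0
      else Min {card F |F. F \<subseteq> undirected_edges H \<and>
                  \<not> connected (with_proj (delete_edges H F))})"

end

theory Submission
  imports Defs
begin

text \<open>
  Let \<open>S\<close> be a set of fewer than \<open>\<delta>(F\<^sub>k(T))\<close> token configurations. Sliding tokens along paths to a
  fixed vertex \<open>l\<close> shows that every component of \<open>F\<^sub>k(T) - S\<close> contains a configuration with \<open>l\<close> occupied
  and one with \<open>l\<close> free. Now let \<open>l\<close> be a leaf. The configurations with \<open>l\<close> free form \<open>F\<^sub>k(T - l)\<close>,
  those with \<open>l\<close> occupied form \<open>F\<^sub>k\<^sub>-\<^sub>1(T - l)\<close>, and \<open>\<delta>(F\<^sub>k(T)) \<le> \<delta>(F\<^sub>k\<^sub>-\<^sub>1(T - l)) + 1\<close>. So either \<open>S\<close> contains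
  no configuration with \<open>l\<close> free, or it has fewer than \<open>\<delta>(F\<^sub>k\<^sub>-\<^sub>1(T - l))\<close> with \<open>l\<close> occupied; by induction
  one of the two parts stays connected, and every component meets it. Hence \<open>\<delta> \<le> \<kappa>\<close>, and
  \<open>\<kappa> \<le> \<lambda> \<le> \<delta>\<close> holds in every graph.
\<close>

section \<open>Trees as symmetric relations\<close>

definition simple_path :: "('a \<times> 'a) set \<Rightarrow> 'a list \<Rightarrow> bool" where
  "simple_path E xs \<longleftrightarrow> distinct xs \<and> successively (\<lambda>x y. (x, y) \<in> E) xs"

lemma simple_path_Nil [simp]: "simple_path E []"
  and simple_path_singleton [simp]: "simple_path E [x]"
  by (simp_all add: simple_path_def)

lemma simple_path_Cons:
  "simple_path E (x # xs) \<longleftrightarrow> x \<notin> set xs \<and> (xs = [] \<or> (x, hd xs) \<in> E) \<and> simple_path E xs"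
  by (auto simp: simple_path_def successively_Cons)

lemma simple_path_append:
  "simple_path E (xs @ ys) \<longleftrightarrow> simple_path E xs \<and> simple_path E ys \<and> set xs \<inter> set ys = {} \<and>
     (xs = [] \<or> ys = [] \<or> (last xs, hd ys) \<in> E)"
  by (auto simp: simple_path_def successively_append_iff)

lemma simple_path_mono:
  assumes "simple_path E xs" "E \<subseteq> F"
  shows "simple_path F xs"
  using assms by (induction xs) (auto simp: simple_path_Cons)

text \<open>Acyclicity is phrased by vertex lists: no edge closes a path on at least three vertices,
  so going back and forth along one edge is not a cycle. With plain sets \<open>V\<close> and
  \<open>E\<close>, deleting a leaf is a mere restriction.\<close>

locale finite_tree =
  fixes V :: "'a set" and E :: "('a \<times> 'a) set"
  assumes finite_verts: "finite V"
    and edges_subset: "E \<subseteq> V \<times> V"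
    and edges_sym: "(x, y) \<in> E \<Longrightarrow> (y, x) \<in> E"
    and edges_irrefl: "(x, x) \<notin> E"
    and reach: "x \<in> V \<Longrightarrow> y \<in> V \<Longrightarrow> (x, y) \<in> E\<^sup>*"
    and no_cycle: "simple_path E xs \<Longrightarrow> 3 \<le> length xs \<Longrightarrow> (last xs, hd xs) \<notin> E"
begin

lemma finite_edges: "finite E"
  using edges_subset finite_verts finite_subset by blast

text \<open>Two neighbours of \<open>u\<close> on the path would close a cycle through
  \<open>u\<close> and the segment between them. This serves both to find leaves and to recover the
  target of a charged move.\<close>

lemma unique_neighbour_on_path:
  assumes "simple_path E ys" "u \<notin> set ys" "x \<in> set ys" "y \<in> set ys" "(u, x) \<in> E" "(u, y) \<in> E"
  shows "x = y"
proof (rule ccontr)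
  assume "x \<noteq> y"
  have False
    if xy: "ys = as @ x # cs @ y # ds" "(u, x) \<in> E" "(u, y) \<in> E" for as cs ds x y
  proof -
    have "simple_path E (u # x # cs @ [y])"
      using assms(1,2) xy by (auto simp: simple_path_append simple_path_Cons hd_append split: if_splits)
    then show False
      using no_cycle[of "u # x # cs @ [y]"] edges_sym xy(3) by auto
  qed
  note no_two = this
  obtain as bs where x: "ys = as @ x # bs"
    using assms(3) by (auto simp: in_set_conv_decomp)
  consider "y \<in> set as" | "y \<in> set bs"
    using x assms(4) \<open>x \<noteq> y\<close> by auto
  then show False
  proof cases
    case 1
    then obtain cs ds where "as = cs @ y # ds"
      by (auto simp: in_set_conv_decomp)
    then show False
      using no_two[of cs y ds x bs] x assms(5,6) by simp
  next
    case 2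
    then obtain cs ds where "bs = cs @ y # ds"
      by (auto simp: in_set_conv_decomp)
    then show False
      using no_two[of as x cs y ds] x assms(5,6) by simp
  qed
qed

lemma exists_path_from_set:
  assumes "a \<in> A" "(a, r) \<in> E\<^sup>*"
  obtains xs where "simple_path E xs" "xs \<noteq> []" "hd xs \<in> A" "last xs = r" "set (tl xs) \<inter> A = {}"
proof -
  \<comment> \<open>The walk is followed backwards from \<open>r\<close>, and its current vertex
    need not lie in \<open>A\<close>; hence the disjunction. Once the head of the path lies in
    \<open>A\<close>, the path is kept; until then its head is the current vertex.\<close>
  have "\<exists>xs. simple_path E xs \<and> xs \<noteq> [] \<and> (hd xs \<in> A \<or> hd xs = a) \<and> last xs = r \<and>
          set (tl xs) \<inter> A = {}"
    using assms(2)
  proof (induction rule: converse_rtrancl_induct)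
    case base
    show ?case
      by (rule exI[of _ "[r]"]) simp
  next
    case (step a b)
    then obtain xs where xs: "simple_path E xs" "xs \<noteq> []" "hd xs \<in> A \<or> hd xs = b"
      "last xs = r" "set (tl xs) \<inter> A = {}"
      by blast
    consider "hd xs \<in> A" | "hd xs = b" "hd xs \<notin> A" "a \<notin> set xs" | "hd xs \<notin> A" "a \<in> set xs"
      using xs(3) by blast
    then show ?case
    proof cases
      case 1
      then show ?thesis
        using xs by blast
    next
      case 2
      have "set xs \<inter> A = {}"
        using 2(2) xs(2,5) by (cases xs) auto
      then show ?thesis
        using 2 xs step.hyps(1) by (intro exI[of _ "a # xs"]) (simp add: simple_path_Cons)
    next
      case 3
      then obtain ys zs where "xs = ys @ a # zs"
        by (auto simp: in_set_conv_decomp)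
      then show ?thesis
        using xs by (intro exI[of _ "a # zs"]) (cases ys; auto simp: simple_path_append simple_path_Cons)
    qed
  qed
  then show thesis
    using that assms(1) by blast
qed

lemma simple_path_subset:
  assumes "simple_path E xs" "xs \<noteq> []" "last xs \<in> V"
  shows "set xs \<subseteq> V"
  using assms edges_subset
  by (induction xs) (auto simp: simple_path_Cons split: if_splits)

lemma simple_path_length_le:
  assumes "simple_path E xs" "set xs \<subseteq> V"
  shows "length xs \<le> card V"
  using assms card_mono[OF finite_verts] distinct_card unfolding simple_path_def by metis

text \<open>The first vertex of a longest path is a leaf: a neighbour off the path would lengthen
  it, and only one neighbour can lie on it.\<close>

lemma exists_leaf:
  assumes "2 \<le> card V"
  obtains l p where "l \<in> V" "(l, p) \<in> E" "\<And>x. (l, x) \<in> E \<Longrightarrow> x = p"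
proof -
  let ?Q = "\<lambda>xs. simple_path E xs \<and> 2 \<le> length xs \<and> set xs \<subseteq> V"
  obtain a b where ab: "a \<in> V" "b \<in> V" "a \<noteq> b"
    using assms by (auto simp: numeral_2_eq_2 card_le_Suc_iff)
  from reach[OF ab(1,2)] \<open>a \<noteq> b\<close> obtain c where "(a, c) \<in> E"
    by (meson converse_rtranclE)
  then have "?Q [a, c]"
    using edges_subset edges_irrefl by (auto simp: simple_path_Cons)
  moreover have "\<forall>xs. ?Q xs \<longrightarrow> length xs < Suc (card V)"
    using simple_path_length_le by (simp add: less_Suc_eq_le)
  ultimately have "\<exists>xs. ?Q xs \<and> (\<forall>ys. ?Q ys \<longrightarrow> length ys \<le> length xs)"
    by (rule ex_has_greatest_nat)
  then obtain xs where xs: "?Q xs" and max: "\<And>ys. ?Q ys \<Longrightarrow> length ys \<le> length xs"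
    by blast
  obtain l p zs where xs_eq: "xs = l # p # zs"
    using xs by (auto simp: numeral_2_eq_2 Suc_le_length_iff)
  have "x = p" if "(l, x) \<in> E" for x
  proof -
    have "x \<in> set xs"
    proof (rule ccontr)
      assume "x \<notin> set xs"
      then have "?Q (x # xs)"
        using xs xs_eq that edges_sym edges_subset by (auto simp: simple_path_Cons)
      then show False
        using max[of "x # xs"] by simp
    qed
    then have "x \<in> set (p # zs)"
      using that edges_irrefl xs_eq by auto
    then show ?thesis
      using unique_neighbour_on_path[of "p # zs" l x p] that xs xs_eq
      by (auto simp: simple_path_Cons)
  qed
  then show thesis
    using that[of l p] xs xs_eq by (auto simp: simple_path_Cons)
qed

lemma remove_leaf:
  assumes "l \<in> V" "(l, p) \<in> E" "\<And>x. (l, x) \<in> E \<Longrightarrow> x = p"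
  shows "finite_tree (V - {l}) (Restr E (V - {l}))"
proof
  show "(x, y) \<in> (Restr E (V - {l}))\<^sup>*" if "x \<in> V - {l}" "y \<in> V - {l}" for x y
  proof -
    \<comment> \<open>Replacing every visit to \<open>l\<close> by \<open>p\<close> makes a walk
      avoid \<open>l\<close>: steps between \<open>l\<close> and \<open>p\<close> become stationary,
      and no other step touches \<open>l\<close>.\<close>
    have "(x, if y = l then p else y) \<in> (Restr E (V - {l}))\<^sup>*" if "(x, y) \<in> E\<^sup>*" for y
      using that
    proof (induction rule: rtrancl_induct)
      case base
      then show ?case
        using \<open>x \<in> V - {l}\<close> by simp
    next
      case (step y z)
      then consider "z = l" "y = p" | "y = l" "z = p" | "y \<noteq> l" "z \<noteq> l"
        using assms(3) edges_sym by blast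
      then show ?case
      proof cases
        case 3
        then have "(y, z) \<in> Restr E (V - {l})"
          using step.hyps(2) edges_subset by auto
        then show ?thesis
          using 3 step.IH by (simp add: rtrancl_into_rtrancl)
      qed (use step.IH in auto)
    qed
    from this[of y] show ?thesis
      using that reach[of x y] by simp
  qed
  show "(last xs, hd xs) \<notin> Restr E (V - {l})"
    if "simple_path (Restr E (V - {l})) xs" "3 \<le> length xs" for xs
    using that no_cycle[of xs] simple_path_mono[of _ xs E] by blast
qed (use finite_verts edges_irrefl in \<open>auto intro: edges_sym\<close>)

lemma boundary_nonempty:
  assumes "A \<subseteq> V" "A \<noteq> {}" "A \<noteq> V"
  shows "\<exists>(a, b) \<in> E. a \<in> A \<and> b \<notin> A"
proof (rule ccontr)
  assume neg: "\<not> ?thesis"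
  obtain a b where ab: "a \<in> A" "b \<in> V - A"
    using assms by blast
  have "y \<in> A" if "(a, y) \<in> E\<^sup>*" for y
    using that by induction (use ab neg in auto)
  then show False
    using reach ab assms by blast
qed

end

section \<open>Token moves\<close>

text \<open>These are the moves available from \<open>A\<close>, so their number is the degree of
  \<open>A\<close> in the token graph (\<open>card_token_moves_Image\<close>).\<close>

definition boundary :: "('a \<times> 'a) set \<Rightarrow> 'a set \<Rightarrow> ('a \<times> 'a) set" where
  "boundary E A = {(a, b) \<in> E. a \<in> A \<and> b \<notin> A}"

text \<open>The number of tokens is not fixed: moves preserve it, so one relation serves both
  \<open>k\<close> and \<open>k - 1\<close> in the induction.\<close>

definition token_moves :: "('a \<times> 'a) set \<Rightarrow> ('a set \<times> 'a set) set" where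
  "token_moves E = {(A, insert b (A - {a})) |A a b. (a, b) \<in> boundary E A}"

lemma token_movesI:
  assumes "(a, b) \<in> E" "a \<in> A" "b \<notin> A"
  shows "(A, insert b (A - {a})) \<in> token_moves E"
  using assms unfolding token_moves_def boundary_def by blast

lemma token_movesE:
  assumes "(A, B) \<in> token_moves E"
  obtains a b where "(a, b) \<in> E" "a \<in> A" "b \<notin> A" "B = insert b (A - {a})"
  using assms unfolding token_moves_def boundary_def by blast

context finite_tree
begin

lemma token_moves_sym:
  assumes "(A, B) \<in> token_moves E"
  shows "(B, A) \<in> token_moves E"
proof -
  obtain a b where ab: "(a, b) \<in> E" "a \<in> A" "b \<notin> A" "B = insert b (A - {a})"
    using assms by (rule token_movesE)
  have "(B, insert a (B - {b})) \<in> token_moves E"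
    using ab edges_irrefl by (intro token_movesI) (auto intro: edges_sym)
  moreover have "insert a (B - {b}) = A"
    using ab by auto
  ultimately show ?thesis
    by simp
qed

lemma token_moves_k_subset:
  assumes "(A, B) \<in> token_moves E" "A \<subseteq> V" "card A = k"
  shows "B \<subseteq> V" "card B = k"
proof -
  obtain a b where ab: "(a, b) \<in> E" "a \<in> A" "b \<notin> A" "B = insert b (A - {a})"
    using assms(1) by (rule token_movesE)
  then show "B \<subseteq> V"
    using assms(2) edges_subset by auto
  have "finite A"
    using assms(2) finite_verts finite_subset by blast
  then show "card B = k"
    using ab assms(3) by (metis DiffD1 card_Suc_Diff1 card_insert_disjoint finite_Diff)
qed

lemma finite_boundary: "finite (boundary E A)"
  by (rule finite_subset[OF _ finite_edges]) (auto simp: boundary_def)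

text \<open>The only token on the path moves along it step by step. Sets in \<open>K\<close> leave
  \<open>r\<close> free, so it cannot arrive while staying in \<open>K\<close>, and some step lands
  in \<open>S\<close>.\<close>

lemma slide_token:
  assumes "simple_path E zs" "zs \<noteq> []" "hd zs \<in> B" "set (tl zs) \<inter> B = {}"
    and "B \<in> K" "last zs = r" "\<And>A. A \<in> K \<Longrightarrow> r \<notin> A" "token_moves E `` K \<subseteq> K \<union> S"
  shows "\<exists>z \<in> set (tl zs). insert z (B - {hd zs}) \<in> S"
  using assms
proof (induction zs arbitrary: B)
  case (Cons v zs)
  obtain z zs' where zs: "zs = z # zs'"
    using Cons.prems by (cases zs) auto
  let ?B = "insert z (B - {v})"
  have "(B, ?B) \<in> token_moves E"
    using Cons.prems zs by (intro token_movesI) (auto simp: simple_path_Cons)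
  then consider "?B \<in> S" | "?B \<in> K"
    using Cons.prems(5,8) by blast
  then show ?case
  proof cases
    case 2
    then have "\<exists>w \<in> set (tl zs). insert w (?B - {hd zs}) \<in> S"
      using Cons.prems zs by (intro Cons.IH) (auto simp: simple_path_Cons)
    \<comment> \<open>The remaining tokens do not change, so the set reached in \<open>S\<close>
      depends only on where the slid token stops.\<close>
    moreover have "?B - {hd zs} = B - {v}"
      using Cons.prems zs by auto
    ultimately show ?thesis
      using zs by auto
  qed (use zs in auto)
qed simp

text \<open>
  Take \<open>A \<in> K\<close> and a token \<open>t\<close> of \<open>A\<close> with a free path to the root \<open>r\<close>, this path being as long as
  possible. Each move from \<open>A\<close> is charged to a set in \<open>S\<close>: if the move itself stays in \<open>K\<close>, the
  token which now starts a free path to \<open>r\<close> is slid towards \<open>r\<close> until \<open>K\<close> is left. Moves of \<open>t\<close> away from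
  \<open>r\<close> leave \<open>K\<close> at once by maximality. The move is recovered from the set it is charged to.
\<close>

lemma card_boundary_le_of_avoiding:
  assumes "K \<noteq> {}" "\<And>A. A \<in> K \<Longrightarrow> A \<subseteq> V \<and> A \<noteq> {} \<and> r \<notin> A" "r \<in> V"
    and closed: "token_moves E `` K \<subseteq> K \<union> S" and "finite S"
  shows "\<exists>A \<in> K. card (boundary E A) \<le> card S"
proof -
  let ?Q = "\<lambda>(A, xs). A \<in> K \<and> simple_path E xs \<and> xs \<noteq> [] \<and> hd xs \<in> A \<and> last xs = r \<and>
              set (tl xs) \<inter> A = {}"
  obtain A0 where A0: "A0 \<in> K"
    using assms(1) by blast
  then obtain a where a: "a \<in> A0"
    using assms(2) by blast
  have "(a, r) \<in> E\<^sup>*"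
    using reach a A0 assms(2,3) by blast
  then obtain xs0 where "?Q (A0, xs0)"
    using exists_path_from_set[OF a] A0 by (smt (verit) case_prodI)
  moreover have "\<forall>Z. ?Q Z \<longrightarrow> length (snd Z) < Suc (card V)"
    using simple_path_length_le simple_path_subset assms(3) by (auto simp: less_Suc_eq_le)
  ultimately have "\<exists>Z. ?Q Z \<and> (\<forall>Y. ?Q Y \<longrightarrow> length (snd Y) \<le> length (snd Z))"
    by (rule ex_has_greatest_nat)
  then obtain Z where "?Q Z" and max: "\<And>Y. ?Q Y \<Longrightarrow> length (snd Y) \<le> length (snd Z)"
    by blast
  then obtain A t ys where A: "A \<in> K" and path: "simple_path E (t # ys)" and t: "t \<in> A"
    and last: "last (t # ys) = r" and free: "set ys \<inter> A = {}" and Z: "Z = (A, t # ys)"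
    by (cases Z; cases "snd Z") auto
  define P where "P = set ys"
  have ys: "simple_path E ys" "ys \<noteq> []" "last ys = r"
    using path last A assms(2) t by (auto simp: simple_path_Cons split: if_splits)
  have PA: "P \<inter> A = {}"
    using free by (simp add: P_def)

  \<comment> \<open>The three cases: the move itself lands in \<open>S\<close>; another token moves
    off the path and then \<open>t\<close> slides to \<open>v\<close>; a token enters the path at
    \<open>x\<close> and slides to \<open>v\<close>, where \<open>v = x\<close> if the move already
    lands in \<open>S\<close>.\<close>
  define charged where "charged = (\<lambda>(u, x) B.
    (x \<notin> P \<and> B = insert x (A - {u})) \<or>
    (x \<notin> P \<and> u \<noteq> t \<and> (\<exists>v \<in> P. B = insert v (insert x (A - {u}) - {t}))) \<or>
    (x \<in> P \<and> (\<exists>v \<in> P. B = insert v (A - {u}))))"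

  have charge: "\<exists>B. B \<in> S \<and> charged e B" if boundary: "e \<in> boundary E A" for e
  proof -
    obtain u x where e: "e = (u, x)" "(u, x) \<in> E" "u \<in> A" "x \<notin> A"
      using boundary unfolding boundary_def by blast
    let ?B = "insert x (A - {u})"
    have move: "?B \<in> K \<union> S"
      using closed A token_movesI[OF e(2-4)] by blast
    show ?thesis
    proof (cases "?B \<in> S")
      case True
      then show ?thesis
        unfolding charged_def e(1) by (intro exI[of _ ?B]) auto
    next
      case False
      then have B: "?B \<in> K"
        using move by blast
      consider "x \<in> P" | "x \<notin> P" "u \<noteq> t" | "x \<notin> P" "u = t"
        by blast
      then show ?thesis
      proof cases
        case 1
        then obtain as bs where split: "ys = as @ x # bs"
          unfolding P_def by (auto simp: in_set_conv_decomp)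
        have "\<exists>z \<in> set (tl (x # bs)). insert z (?B - {hd (x # bs)}) \<in> S"
          using ys split PA B assms(2) closed
          by (intro slide_token[of "x # bs" ?B K r]) (auto simp: simple_path_append simple_path_Cons P_def)
        moreover have "?B - {x} = A - {u}"
          using e by auto
        ultimately show ?thesis
          unfolding charged_def e(1) P_def using split by auto
      next
        case 2
        have "\<exists>z \<in> set (tl (t # ys)). insert z (?B - {hd (t # ys)}) \<in> S"
          using path last PA t B 2 assms(2) closed
          by (intro slide_token[of "t # ys" ?B K r]) (auto simp: P_def)
        then show ?thesis
          unfolding charged_def e(1) P_def using 2 by (auto simp: P_def)
      next
        case 3
        have "?Q (?B, x # t # ys)"
          using path last PA t B 3 e edges_sym by (auto simp: P_def simple_path_Cons)
        then show ?thesis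
          using max[of "(?B, x # t # ys)"] Z by simp
      qed
    qed
  qed
  have inj: "e = e'"
    if "e \<in> boundary E A" "e' \<in> boundary E A" "B \<in> S" "charged e B" "charged e' B" for e e' B
  proof -
    obtain u x u' x' where e: "e = (u, x)" "e' = (u', x')"
      by fastforce
    \<comment> \<open>What \<open>B\<close> reveals: the vacated vertices are \<open>u\<close> and
      possibly the fixed vertex \<open>t\<close>, and outside \<open>P\<close> the only newly
      occupied vertex is \<open>x\<close>, if \<open>x\<close> is not on \<open>P\<close>.\<close>
    have traces: "(A - B = {u} \<or> A - B = {u, t} \<and> u \<noteq> t) \<and> B - A - P = {x} - P"
      if "charged (u, x) B" "(u, x) \<in> boundary E A" for u x
      using that PA t unfolding charged_def boundary_def by auto
    have tr: "A - B = {u} \<or> A - B = {u, t} \<and> u \<noteq> t" "B - A - P = {x} - P"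
      and tr': "A - B = {u'} \<or> A - B = {u', t} \<and> u' \<noteq> t" "B - A - P = {x'} - P"
      using traces that e by blast+
    have "u = u'" if "D = {u} \<or> D = {u, t} \<and> u \<noteq> t" "D = {u'} \<or> D = {u', t} \<and> u' \<noteq> t" for D
      using that by (elim disjE) (auto simp: doubleton_eq_iff)
    from this[OF tr(1) tr'(1)] have "u = u'" .
    have "{x} - P = {x'} - P"
      using tr(2) tr'(2) by simp
    then have x_iff: "x \<in> P \<longleftrightarrow> x' \<in> P" "x \<notin> P \<Longrightarrow> x = x'"
      by (simp_all add: insert_Diff_if split: if_splits)
    have "x = x'"
    proof (cases "x \<in> P")
      case True
      then have "x' \<in> P"
        using x_iff by simp
      \<comment> \<open>A target on \<open>P\<close> is not visible in \<open>B\<close>, but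
        \<open>u\<close> lies off the path and has at most one neighbour on it.\<close>
      have "u \<notin> P" "(u, x) \<in> E" "(u, x') \<in> E"
        using that(1,2) \<open>u = u'\<close> e PA by (auto simp: boundary_def)
      then show ?thesis
        using unique_neighbour_on_path[OF ys(1)] True \<open>x' \<in> P\<close> unfolding P_def by blast
    next
      case False
      then show ?thesis
        by (rule x_iff)
    qed
    then show ?thesis
      using e \<open>u = u'\<close> by simp
  qed
  have "card (boundary E A) \<le> card S"
    using assms(5) charge inj by (rule card_le_if_inj_on_rel)
  then show ?thesis
    using A by blast
qed

section \<open>Exchanging tokens and free vertices\<close>

lemma boundary_complement:
  assumes "A \<subseteq> V"
  shows "boundary E (V - A) = (boundary E A)\<inverse>"
  using assms edges_subset edges_sym by (auto simp: boundary_def)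

lemma token_moves_complement:
  assumes "(V - A, B) \<in> token_moves E" "A \<subseteq> V"
  shows "(A, V - B) \<in> token_moves E"
proof -
  obtain a b where ab: "(a, b) \<in> E" "a \<in> V - A" "b \<notin> V - A" "B = insert b ((V - A) - {a})"
    using assms(1) by (rule token_movesE)
  have "(A, insert a (A - {b})) \<in> token_moves E"
    using ab edges_subset by (intro token_movesI) (auto intro: edges_sym)
  moreover have "V - B = insert a (A - {b})"
    using ab assms(2) edges_subset by auto
  ultimately show ?thesis
    by simp
qed

text \<open>Dual of \<open>card_boundary_le_of_avoiding\<close>: complementation turns an occupied
  \<open>r\<close> into a free one and keeps the sizes of boundaries.\<close>

lemma card_boundary_le_of_containing:
  assumes "K \<noteq> {}" "\<And>A. A \<in> K \<Longrightarrow> A \<subseteq> V \<and> A \<noteq> V \<and> r \<in> A"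
    and closed: "token_moves E `` K \<subseteq> K \<union> S" and "finite S"
  shows "\<exists>A \<in> K. card (boundary E A) \<le> card S"
proof -
  let ?c = "\<lambda>A. V - A"
  have "\<exists>A \<in> ?c ` K. card (boundary E A) \<le> card (?c ` S)"
  proof (rule card_boundary_le_of_avoiding)
    show "token_moves E `` (?c ` K) \<subseteq> ?c ` K \<union> ?c ` S"
    proof
      fix B assume "B \<in> token_moves E `` (?c ` K)"
      then obtain A where A: "A \<in> K" "(V - A, B) \<in> token_moves E"
        by blast
      have "V - B \<in> K \<union> S"
        using token_moves_complement[OF A(2)] A(1) assms(2) closed by blast
      moreover have "B = V - (V - B)"
        using token_moves_k_subset[OF A(2)] by auto
      ultimately show "B \<in> ?c ` K \<union> ?c ` S"
        by blast
    qed
    show "r \<in> V"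
      using assms(1,2) by blast
    show "B \<subseteq> V \<and> B \<noteq> {} \<and> r \<notin> B" if "B \<in> ?c ` K" for B
      using that assms(2) by blast
  qed (use assms in auto)
  then obtain A where "A \<in> K" "card (boundary E (V - A)) \<le> card (?c ` S)"
    by blast
  \<comment> \<open>\<open>S\<close> may contain sets not inside \<open>V\<close>, on which
    complementation need not be injective; the inequality suffices.\<close>
  moreover have "card (?c ` S) \<le> card S"
    using assms(4) by (rule card_image_le)
  moreover have "card (boundary E (V - A)) = card (boundary E A)"
    using boundary_complement assms(2) \<open>A \<in> K\<close> by (metis card_inverse)
  ultimately show ?thesis
    by (metis order_trans)
qed

end

section \<open>Connectedness after deleting few token configurations\<close>

text \<open>Carries walks from the tree without the leaf \<open>l\<close> back to the whole tree,
  with \<open>L = {}\<close> when \<open>l\<close> stays free and \<open>L = {l}\<close> when it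
  stays occupied.\<close>

lemma lift_token_walk:
  assumes "(A, B) \<in> (Restr (token_moves E') (- S'))\<^sup>*" "A \<subseteq> W"
    and "E' \<subseteq> E" "E' \<subseteq> W \<times> W" "L \<inter> W = {}"
    and avoid: "\<And>Y. Y \<subseteq> W \<Longrightarrow> Y \<notin> S' \<Longrightarrow> Y \<union> L \<notin> S"
  shows "(A \<union> L, B \<union> L) \<in> (Restr (token_moves E) (- S))\<^sup>*"
proof -
  have "B \<subseteq> W \<and> (A \<union> L, B \<union> L) \<in> (Restr (token_moves E) (- S))\<^sup>*"
    using assms(1)
  proof (induction rule: rtrancl_induct)
    case base
    then show ?case
      using assms(2) by simp
  next
    case (step Y Z)
    then obtain a b where ab: "(a, b) \<in> E'" "a \<in> Y" "b \<notin> Y" "Z = insert b (Y - {a})"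
      by (auto elim: token_movesE)
    then have "(Y \<union> L, insert b (Y \<union> L - {a})) \<in> token_moves E"
      using step.IH assms(3-5) by (intro token_movesI) auto
    moreover have "insert b (Y \<union> L - {a}) = Z \<union> L"
      using ab assms(4,5) by auto
    moreover have "Z \<subseteq> W"
      using ab step.IH assms(4) by auto
    ultimately have "(Y \<union> L, Z \<union> L) \<in> Restr (token_moves E) (- S)"
      using avoid step by auto
    then show ?case
      using step.IH \<open>Z \<subseteq> W\<close> by (auto intro: rtrancl_into_rtrancl)
  qed
  then show ?thesis ..
qed

context finite_tree
begin

lemma token_walk_in_k_subsets:
  assumes "(A, B) \<in> (Restr (token_moves E) (- S))\<^sup>*" "A \<subseteq> V" "card A = k" "A \<notin> S"
  shows "B \<subseteq> V \<and> card B = k \<and> B \<notin> S"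
  using assms by (induction rule: rtrancl_induct) (auto dest: token_moves_k_subset)

text \<open>The component \<open>K\<close> of \<open>A\<close> can only be left through
  \<open>S\<close>. If \<open>l\<close> were free throughout \<open>K\<close>, or occupied
  throughout, some member of \<open>K\<close> would have degree at most
  \<open>card S\<close>.\<close>

lemma token_walk_to_containing_and_avoiding:
  assumes "finite S" "\<And>A. A \<subseteq> V \<Longrightarrow> card A = k \<Longrightarrow> card S < card (boundary E A)"
    and "0 < k" "k < card V" "l \<in> V" "A \<subseteq> V" "card A = k" "A \<notin> S"
  shows "\<exists>B. (A, B) \<in> (Restr (token_moves E) (- S))\<^sup>* \<and> l \<in> B"
    and "\<exists>B. (A, B) \<in> (Restr (token_moves E) (- S))\<^sup>* \<and> l \<notin> B"
proof -
  define K where "K = (Restr (token_moves E) (- S))\<^sup>* `` {A}"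
  have "A \<in> K"
    by (simp add: K_def)
  have K: "B \<subseteq> V \<and> card B = k \<and> B \<notin> S" if "B \<in> K" for B
    using token_walk_in_k_subsets that assms(6-8) by (simp add: K_def)
  have closed: "token_moves E `` K \<subseteq> K \<union> S"
  proof
    fix C assume "C \<in> token_moves E `` K"
    then obtain B where "B \<in> K" "(B, C) \<in> token_moves E"
      by blast
    then show "C \<in> K \<union> S"
      using K[of B] by (auto simp: K_def intro: rtrancl_into_rtrancl)
  qed
  have large: "\<not> (\<exists>B \<in> K. card (boundary E B) \<le> card S)"
    using K assms(2) by (auto simp: not_le)
  have nontriv: "B \<noteq> {} \<and> B \<noteq> V" if "B \<in> K" for B
    using K[OF that] assms(3,4) by auto
  have "\<exists>B \<in> K. l \<in> B"
    using card_boundary_le_of_avoiding[of K l S] \<open>A \<in> K\<close> K nontriv closed large assms(1,5) by blast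
  then show "\<exists>B. (A, B) \<in> (Restr (token_moves E) (- S))\<^sup>* \<and> l \<in> B"
    by (auto simp: K_def)
  have "\<exists>B \<in> K. l \<notin> B"
    using card_boundary_le_of_containing[of K l S] \<open>A \<in> K\<close> K nontriv closed large assms(1) by blast
  then show "\<exists>B. (A, B) \<in> (Restr (token_moves E) (- S))\<^sup>* \<and> l \<notin> B"
    by (auto simp: K_def)
qed

lemma token_walk_sym:
  assumes "(A, B) \<in> (Restr (token_moves E) (- S))\<^sup>*"
  shows "(B, A) \<in> (Restr (token_moves E) (- S))\<^sup>*"
proof -
  have "sym (Restr (token_moves E) (- S))"
    by (auto intro!: symI token_moves_sym)
  then show ?thesis
    using assms sym_rtrancl symD by metis
qed

end

text \<open>
  The case \<open>S = {}\<close> is included so that the induction also covers \<open>k = 0\<close> and \<open>k = card V\<close>, where the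
  boundaries are empty.
\<close>

lemma token_moves_connected:
  assumes "finite_tree V E" "finite S"
    and "S = {} \<or> (\<forall>A. A \<subseteq> V \<longrightarrow> card A = k \<longrightarrow> card S < card (boundary E A))"
    and "A \<subseteq> V" "card A = k" "A \<notin> S" "B \<subseteq> V" "card B = k" "B \<notin> S"
  shows "(A, B) \<in> (Restr (token_moves E) (- S))\<^sup>*"
  using assms
proof (induction "card V" arbitrary: V E k S A B rule: less_induct)
  case less
  interpret finite_tree V E
    by fact
  have fin: "finite X" if "X \<subseteq> V" for X
    using that finite_verts finite_subset by blast
  have "k \<le> card V"
    using less.prems(4,5) card_mono[OF finite_verts, of A] by simp
  then consider "k = 0" | "k = card V" | "0 < k" "k < card V"
    by linarith
  then show ?case
  proof cases
    case 1
    then show ?thesis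
      using less.prems fin by simp
  next
    case 2
    then have "A = V" "B = V"
      using less.prems(4,5,7,8) finite_verts by (simp_all add: card_subset_eq)
    then show ?thesis
      by simp
  next
    case 3
    have small: "card S < card (boundary E X)" if "X \<subseteq> V" "card X = k" for X
    proof (cases "S = {}")
      case True
      have "\<exists>(a, b) \<in> E. a \<in> X \<and> b \<notin> X"
        using that 3 by (intro boundary_nonempty) auto
      then have "boundary E X \<noteq> {}"
        by (auto simp: boundary_def)
      then show ?thesis
        using True finite_boundary by (simp add: card_gt_0_iff)
    next
      case False
      then show ?thesis
        using less.prems(3) that by blast
    qed
    have "2 \<le> card V"
      using 3 by simp
    then obtain l p where leaf: "l \<in> V" "(l, p) \<in> E" "\<And>x. (l, x) \<in> E \<Longrightarrow> x = p"
      by (rule exists_leaf) blast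
    define W where "W = V - {l}"
    define E' where "E' = Restr E W"
    have T': "finite_tree W E'"
      unfolding W_def E'_def using leaf by (rule remove_leaf)
    have "card W < card V"
      unfolding W_def using leaf(1) finite_verts by (rule card_Diff1_less[rotated])
    have E': "E' \<subseteq> E" "E' \<subseteq> W \<times> W"
      by (auto simp: E'_def)
    \<comment> \<open>The deleted configurations are split by the state of \<open>l\<close>;
      \<open>S1\<close> records those with \<open>l\<close> occupied as configurations on
      \<open>W\<close>.\<close>
    define S0 where "S0 = {X \<in> S. l \<notin> X}"
    define S1 where "S1 = (\<lambda>X. X - {l}) ` {X \<in> S. l \<in> X}"
    have S1_iff: "Y \<in> S1 \<longleftrightarrow> insert l Y \<in> S" if "l \<notin> Y" for Y
    proof
      assume "insert l Y \<in> S"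
      then have "insert l Y - {l} \<in> S1"
        unfolding S1_def by blast
      then show "Y \<in> S1"
        using that by simp
    qed (auto simp: S1_def insert_absorb)
    let ?R = "(Restr (token_moves E) (- S))\<^sup>*"
    have walks: "\<exists>Y. (X, Y) \<in> ?R \<and> l \<in> Y" "\<exists>Y. (X, Y) \<in> ?R \<and> l \<notin> Y"
      if "X \<subseteq> V" "card X = k" "X \<notin> S" for X
      by (rule token_walk_to_containing_and_avoiding[OF less.prems(2) small 3 leaf(1) that],
          assumption+)+
    obtain A' B' where A': "(A, A') \<in> ?R" and B': "(B, B') \<in> ?R" and "(A', B') \<in> ?R"
    proof (cases "S0 = {}")
      case True
      obtain A' B' where A': "(A, A') \<in> ?R" "l \<notin> A'" and B': "(B, B') \<in> ?R" "l \<notin> B'"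
        using walks(2)[OF less.prems(4-6)] walks(2)[OF less.prems(7-9)] by blast
      have "A' \<subseteq> W" "card A' = k" "B' \<subseteq> W" "card B' = k"
        using token_walk_in_k_subsets[OF A'(1) less.prems(4-6)] A'(2)
          token_walk_in_k_subsets[OF B'(1) less.prems(7-9)] B'(2)
        by (auto simp: W_def)
      \<comment> \<open>Here \<open>k = card W\<close> is possible, where boundaries are empty; as
        nothing is deleted, the alternative \<open>S = {}\<close> of the induction hypothesis
        applies.\<close>
      then have "(A', B') \<in> (Restr (token_moves E') (- {}))\<^sup>*"
        using \<open>card W < card V\<close> T' by (intro less.hyps) auto
      then have "(A' \<union> {}, B' \<union> {}) \<in> ?R"
        by (rule lift_token_walk[OF _ \<open>A' \<subseteq> W\<close> E']) (use True in \<open>auto simp: S0_def W_def\<close>)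
      then show thesis
        using that A' B' by simp
    next
      case False
      obtain A' B' where A': "(A, A') \<in> ?R" "l \<in> A'" and B': "(B, B') \<in> ?R" "l \<in> B'"
        using walks(1)[OF less.prems(4-6)] walks(1)[OF less.prems(7-9)] by blast
      have "A' \<subseteq> V \<and> card A' = k \<and> A' \<notin> S" "B' \<subseteq> V \<and> card B' = k \<and> B' \<notin> S"
        using token_walk_in_k_subsets[OF A'(1) less.prems(4-6)]
          token_walk_in_k_subsets[OF B'(1) less.prems(7-9)]
        by simp_all
      then have AB: "A' - {l} \<subseteq> W" "card (A' - {l}) = k - 1" "A' - {l} \<notin> S1"
          "B' - {l} \<subseteq> W" "card (B' - {l}) = k - 1" "B' - {l} \<notin> S1"
        using A'(2) B'(2) fin by (auto simp: W_def S1_iff insert_absorb)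
      have "card S1 < card S"
      proof -
        have "card S1 \<le> card {X \<in> S. l \<in> X}"
          unfolding S1_def using less.prems(2) by (intro card_image_le) simp
        also have "\<dots> < card S"
          using False less.prems(2) by (intro psubset_card_mono) (auto simp: S0_def)
        finally show ?thesis .
      qed
      have "card S1 < card (boundary E' X)" if "X \<subseteq> W" "card X = k - 1" for X
      proof -
        have "X \<subseteq> V" "l \<notin> X"
          using that(1) by (auto simp: W_def)
        then have "card S < card (boundary E (insert l X))"
          using that(2) 3 leaf(1) fin[of X] by (intro small) simp_all
        \<comment> \<open>An occupied \<open>l\<close> contributes at most the edge to
          \<open>p\<close>, and edges into \<open>l\<close> are no moves, so the degree drops by at
          most one, as does the number of deleted sets.\<close>
        also have "\<dots> \<le> card (insert (l, p) (boundary E' X))"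
        proof (rule card_mono)
          show "finite (insert (l, p) (boundary E' X))"
            using finite_tree.finite_boundary[OF T'] by simp
          show "boundary E (insert l X) \<subseteq> insert (l, p) (boundary E' X)"
            using leaf(3) edges_subset that by (auto simp: boundary_def E'_def W_def)
        qed
        also have "\<dots> \<le> Suc (card (boundary E' X))"
          by (rule card_insert_le_m1) auto
        finally show ?thesis
          using \<open>card S1 < card S\<close> by simp
      qed
      then have "(A' - {l}, B' - {l}) \<in> (Restr (token_moves E') (- S1))\<^sup>*"
        using \<open>card W < card V\<close> T' AB less.prems(2)
        by (intro less.hyps[where k = "k - 1"]) (simp_all add: S1_def)
      then have "(A' - {l} \<union> {l}, B' - {l} \<union> {l}) \<in> ?R"
        by (rule lift_token_walk[OF _ AB(1) E']) (auto simp: W_def S1_iff subset_Diff_insert)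
      moreover have "A' - {l} \<union> {l} = A'" "B' - {l} \<union> {l} = B'"
        using A' B' by auto
      ultimately show thesis
        using that A' B' by simp
    qed
    then show ?thesis
      using token_walk_sym[OF B'] by (meson rtrancl_trans)
  qed
qed

section \<open>Connectivity, edge-connectivity and minimum degree\<close>

lemma rtrancl_on_iff_rtrancl:
  assumes "R \<subseteq> V \<times> V" "u \<in> V"
  shows "(u, v) \<in> rtrancl_on V R \<longleftrightarrow> (u, v) \<in> R\<^sup>*"
proof
  show "(u, v) \<in> rtrancl_on V R" if "(u, v) \<in> R\<^sup>*"
    using that assms
    by (induction rule: rtrancl_induct) (auto intro: rtrancl_on_into_rtrancl_on)
qed (rule rtrancl_on_rtranclI)

lemma connected_with_proj_iff:
  assumes "sym (parcs H)" "parcs H \<subseteq> pverts H \<times> pverts H"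
  shows "connected (with_proj H) \<longleftrightarrow>
    pverts H \<noteq> {} \<and> (\<forall>u \<in> pverts H. \<forall>v \<in> pverts H. (u, v) \<in> (parcs H)\<^sup>*)"
proof -
  have "parcs (mk_symmetric (with_proj H)) = parcs H"
    using assms(1) by (auto simp: parcs_mk_symmetric dest: symD)
  then show ?thesis
    using assms(2)
    by (auto simp: connected_def strongly_connected_def reachable_def rtrancl_on_iff_rtrancl)
qed

lemma connected_induce_iff:
  assumes "sym (parcs H)"
  shows "connected (induce_subgraph (with_proj H) W) \<longleftrightarrow>
    W \<noteq> {} \<and> (\<forall>u \<in> W. \<forall>v \<in> W. (u, v) \<in> (Restr (parcs H) W)\<^sup>*)"
proof -
  let ?H = "\<lparr>pverts = W, parcs = Restr (parcs H) W\<rparr>"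
  have "induce_subgraph (with_proj H) W = with_proj ?H"
    by (auto simp: induce_subgraph_def with_proj_def)
  moreover have "sym (parcs ?H)"
    using assms by (auto simp: sym_def)
  ultimately show ?thesis
    using connected_with_proj_iff[of ?H] by auto
qed

lemma connected_delete_edges_iff:
  assumes "sym (parcs H)" "parcs H \<subseteq> pverts H \<times> pverts H"
  shows "connected (with_proj (delete_edges H F)) \<longleftrightarrow> pverts H \<noteq> {} \<and>
    (\<forall>u \<in> pverts H. \<forall>v \<in> pverts H. (u, v) \<in> {(u, v) \<in> parcs H. {u, v} \<notin> F}\<^sup>*)"
proof -
  have "sym (parcs (delete_edges H F))"
    using assms(1) by (auto simp: sym_def delete_edges_def insert_commute)
  then show ?thesis
    using connected_with_proj_iff[of "delete_edges H F"] assms(2) by (auto simp: delete_edges_def)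
qed

lemma out_degree_with_proj: "out_degree (with_proj H) v = card (parcs H `` {v})"
proof -
  have "bij_betw snd (out_arcs (with_proj H) v) (parcs H `` {v})"
    by (rule bij_betw_byWitness[of _ "Pair v"]) (auto simp: out_arcs_def)
  then show ?thesis
    by (simp add: out_degree_def bij_betw_same_card)
qed

text \<open>
  Whitney's argument: given an edge cut \<open>F\<close> between \<open>K\<close> and its complement, pick non-adjacent
  \<open>u \<in> K\<close>, \<open>w \<notin> K\<close>; every edge of \<open>F\<close> has an endpoint other than \<open>u\<close>, \<open>w\<close>, and such endpoints separate
  \<open>u\<close> from \<open>w\<close>. If no such pair exists, \<open>F\<close> has at least \<open>card V - 1\<close> edges.
\<close>

lemma edge_deletion_connected:
  assumes "finite V" "R \<subseteq> V \<times> V" "sym R" "d < card V"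
    and vertex: "\<And>S u v. \<lbrakk>S \<subseteq> V; card S < d; u \<in> V - S; v \<in> V - S\<rbrakk> \<Longrightarrow> (u, v) \<in> (Restr R (V - S))\<^sup>*"
    and F: "F \<subseteq> {{u, v} |u v. (u, v) \<in> R}" "card F < d"
    and "x \<in> V" "y \<in> V"
  shows "(x, y) \<in> {(u, v) \<in> R. {u, v} \<notin> F}\<^sup>*"
proof (rule ccontr)
  let ?R = "{(u, v) \<in> R. {u, v} \<notin> F}"
  assume neg: "(x, y) \<notin> ?R\<^sup>*"
  define K where "K = ?R\<^sup>* `` {x}"
  have "x \<in> K" "y \<notin> K"
    using neg by (auto simp: K_def)
  have "K \<subseteq> V"
  proof
    fix z assume "z \<in> K"
    then have "(x, z) \<in> ?R\<^sup>*"
      by (simp add: K_def)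
    then show "z \<in> V"
      by (induction rule: rtrancl_induct) (use assms(2,8) in auto)
  qed
  then have finK: "finite K"
    using assms(1) finite_subset by blast
  have "finite F"
  proof (rule finite_subset)
    show "F \<subseteq> Pow V"
      using F(1) assms(2) by auto
  qed (use assms(1) in simp)
  have cut: "{u, w} \<in> F" if "(u, w) \<in> R" "u \<in> K" "w \<notin> K" for u w
    using that by (auto simp: K_def intro: rtrancl_into_rtrancl)
  have "\<exists>u \<in> K. \<exists>w \<in> V - K. (u, w) \<notin> R"
  proof (rule ccontr)
    assume "\<not> ?thesis"
    then have all: "(u, w) \<in> R" if "u \<in> K" "w \<in> V - K" for u w
      using that by blast
    have "card (K \<times> (V - K)) \<le> card F"
    proof (rule card_inj_on_le)
      show "inj_on (\<lambda>(u, w). {u, w}) (K \<times> (V - K))"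
        by (auto simp: inj_on_def doubleton_eq_iff)
      show "(\<lambda>(u, w). {u, w}) ` (K \<times> (V - K)) \<subseteq> F"
        using cut all by auto
    qed fact
    moreover have "card V = card K + card (V - K)"
      using \<open>K \<subseteq> V\<close> finK assms(1) by (metis card_Diff_subset card_mono le_add_diff_inverse)
    moreover have "card K > 0" "card (V - K) > 0"
      using \<open>x \<in> K\<close> \<open>y \<notin> K\<close> assms(1,9) finK by (auto simp: card_gt_0_iff)
    \<comment> \<open>This makes the complete cut have at least \<open>card V - 1\<close>, hence at
      least \<open>d\<close>, edges.\<close>
    moreover have "a + b \<le> Suc (a * b)" if "a > 0" "b > 0" for a b :: nat
      using that by (cases a; cases b) auto
    note this[of "card K" "card (V - K)"]
    ultimately show False
      using F(2) assms(4) by (simp add: card_cartesian_product)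
  qed
  then obtain u w where uw: "u \<in> K" "w \<in> V - K" "(u, w) \<notin> R"
    by blast
  \<comment> \<open>From each cut edge take its endpoint in \<open>K\<close>, unless that is
    \<open>u\<close>; then take the other one.\<close>
  define S where "S = {s \<in> V. if s \<in> K then s \<noteq> u \<and> (\<exists>z \<in> V - K. {s, z} \<in> F) else {u, s} \<in> F}"
  have "card S \<le> card F"
  proof (rule card_le_if_inj_on_rel[where r = "\<lambda>s e. if s \<in> K then s \<noteq> u \<and> (\<exists>z \<in> V - K. e = {s, z})
            else e = {u, s}"])
    show "s = s'" if "s \<in> S" "s' \<in> S"
        "if s \<in> K then s \<noteq> u \<and> (\<exists>z \<in> V - K. e = {s, z}) else e = {u, s}"
        "if s' \<in> K then s' \<noteq> u \<and> (\<exists>z \<in> V - K. e = {s', z}) else e = {u, s'}" for s s' e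
      using that uw by (auto simp: doubleton_eq_iff split: if_splits)
  qed (use \<open>finite F\<close> in \<open>auto simp: S_def split: if_splits\<close>)
  moreover have "S \<subseteq> V"
    by (auto simp: S_def)
  moreover have "u \<in> V - S"
    using uw \<open>K \<subseteq> V\<close> by (auto simp: S_def)
  moreover have "{u, w} \<notin> F"
  proof
    assume "{u, w} \<in> F"
    then obtain a b where "(a, b) \<in> R" "{u, w} = {a, b}"
      using F(1) by blast
    then show False
      using uw(3) assms(3) by (auto simp: doubleton_eq_iff dest: symD)
  qed
  then have "w \<in> V - S"
    using uw by (auto simp: S_def)
  ultimately have "(u, w) \<in> (Restr R (V - S))\<^sup>*"
    using F(2) by (intro vertex) auto
  \<comment> \<open>A walk from \<open>u\<close> avoiding \<open>S\<close> stays in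
    \<open>K\<close>: a step out of \<open>K\<close> uses an edge of \<open>F\<close>, which starts
    in \<open>S\<close> or goes from \<open>u\<close> into \<open>S\<close>.\<close>
  then have "w \<in> K"
  proof (induction rule: rtrancl_induct)
    case (step a b)
    then show ?case
      using cut[of a b] by (auto simp: S_def split: if_splits)
  qed (use uw in simp)
  then show False
    using uw by blast
qed

text \<open>The lower bounds come from \<open>vertex\<close> and
  \<open>edge_deletion_connected\<close>; the upper bounds come from isolating a vertex
  \<open>v\<close> of minimum degree.\<close>

lemma connectivity_eq_min_degree:
  fixes H :: "'b pair_pre_digraph"
  assumes "pair_graph H" "2 \<le> card (pverts H)"
    and vertex: "\<And>S u v. \<lbrakk>S \<subseteq> pverts H; card S < min_degree H; u \<in> pverts H - S; v \<in> pverts H - S\<rbrakk>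
      \<Longrightarrow> (u, v) \<in> (Restr (parcs H) (pverts H - S))\<^sup>*"
  shows "vertex_connectivity H = min_degree H" "edge_connectivity H = min_degree H"
proof -
  interpret pair_graph H
    by fact
  let ?V = "pverts H" and ?R = "parcs H" and ?d = "min_degree H"
  have fin: "finite ?V"
    by (rule pair_finite_verts)
  have R: "?R \<subseteq> ?V \<times> ?V" "sym ?R"
    by (auto intro: symI arcs_symmetric dest: in_arcsD1 in_arcsD2)
  have nbrs: "?R `` {v} \<subseteq> ?V - {v}" for v
    using in_arcsD2 no_loops' by auto
  have "?V \<noteq> {}"
    using assms(2) by auto
  have d_eq: "?d = Min ((\<lambda>v. card (?R `` {v})) ` ?V)"
    by (simp add: min_degree_def out_degree_with_proj)
  have d_le: "?d \<le> card (?R `` {v})" if "v \<in> ?V" for v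
    unfolding d_eq using fin that by simp
  obtain v where v: "v \<in> ?V" "card (?R `` {v}) = ?d"
  proof -
    have "?d \<in> (\<lambda>v. card (?R `` {v})) ` ?V"
      unfolding d_eq using fin \<open>?V \<noteq> {}\<close> by (intro Min_in) auto
    then show thesis
      using that by auto
  qed
  have d_less: "?d < card ?V"
    using psubset_card_mono[OF fin, of "?R `` {v}"] nbrs[of v] v by auto
  show "vertex_connectivity H = ?d"
  proof (cases "complete_digraph (card ?V) (with_proj H)")
    case True
    then have "?R `` {v} = ?V - {v}"
      using v(1) by (auto simp: complete_digraph_def)
    then have "?d = card ?V - 1"
      using v fin by simp
    then show ?thesis
      using True by (simp add: vertex_connectivity_def)
  next
    case False
    let ?M = "{card S |S. S \<subset> ?V \<and> \<not> connected (induce_subgraph (with_proj H) (?V - S))}"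
    have "Min ?M = ?d"
    proof (rule Min_eqI)
      have "?M \<subseteq> card ` Pow ?V"
        by auto
      then show "finite ?M"
        by (rule finite_subset) (use fin in simp)
      show "?d \<le> m" if "m \<in> ?M" for m
        using that vertex R by (force simp: connected_induce_iff)
      obtain x y where xy: "x \<in> ?V" "y \<in> ?V" "x \<noteq> y" "(x, y) \<notin> ?R"
      proof -
        have "?R \<noteq> {(x, y). (x, y) \<in> ?V \<times> ?V \<and> x \<noteq> y}"
          using False pair_graphD_graph by (simp add: complete_digraph_def)
        moreover have "?R \<subseteq> {(x, y). (x, y) \<in> ?V \<times> ?V \<and> x \<noteq> y}"
          using nbrs in_arcsD1 by blast
        ultimately show thesis
          using that by blast
      qed
      \<comment> \<open>A non-adjacent pair forces the minimum degree down to at most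
        \<open>card (pverts H) - 2\<close>, so deleting the neighbours of \<open>v\<close> leaves
        some \<open>w\<close> besides \<open>v\<close>.\<close>
      have "?d \<le> card (?V - {x, y})"
      proof -
        have "?R `` {x} \<subseteq> ?V - {x, y}"
          using nbrs[of x] xy(4) by auto
        then have "card (?R `` {x}) \<le> card (?V - {x, y})"
          by (rule card_mono[rotated]) (use fin in simp)
        then show ?thesis
          using d_le[OF xy(1)] by simp
      qed
      then have "Suc ?d < card ?V"
        using xy fin card_mono[of ?V "{x, y}"] by (simp add: card_Diff_subset)
      have "\<not> ?V \<subseteq> insert v (?R `` {v})"
      proof
        assume "?V \<subseteq> insert v (?R `` {v})"
        then have "card ?V \<le> card (insert v (?R `` {v}))"
          by (intro card_mono finite.insertI finite_subset[OF nbrs]) (use fin in auto)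
        also have "\<dots> \<le> Suc ?d"
          using v(2) by (metis card_insert_le_m1 diff_Suc_1 le_refl zero_less_Suc)
        finally show False
          using \<open>Suc ?d < card ?V\<close> by simp
      qed
      then obtain w where w: "w \<in> ?V" "w \<noteq> v" "w \<notin> ?R `` {v}"
        by blast
      have "(v, w) \<notin> (Restr ?R (?V - ?R `` {v}))\<^sup>*"
        using w(2) by (auto elim: converse_rtranclE)
      then have "\<not> connected (induce_subgraph (with_proj H) (?V - ?R `` {v}))"
        using w v nbrs[of v] R by (auto simp: connected_induce_iff)
      moreover have "?R `` {v} \<subset> ?V"
        using nbrs[of v] v by auto
      ultimately show "?d \<in> ?M"
        unfolding v(2)[symmetric] by blast
    qed
    then show ?thesis
      using False by (simp add: vertex_connectivity_def)
  qed
  show "edge_connectivity H = ?d"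
  proof -
    let ?M = "{card F |F. F \<subseteq> undirected_edges H \<and> \<not> connected (with_proj (delete_edges H F))}"
    have "Min ?M = ?d"
    proof (rule Min_eqI)
      have "undirected_edges H \<subseteq> Pow ?V"
        using R(1) by (auto simp: undirected_edges_def)
      then have "finite (undirected_edges H)"
        by (rule finite_subset) (use fin in simp)
      moreover have "?M \<subseteq> card ` Pow (undirected_edges H)"
        by auto
      ultimately show "finite ?M"
        by (meson finite_Pow_iff finite_imageI finite_subset)
      show "?d \<le> m" if m: "m \<in> ?M" for m
      proof (rule ccontr)
        assume "\<not> ?d \<le> m"
        moreover obtain F where F: "m = card F" "F \<subseteq> {{u, v} |u v. (u, v) \<in> ?R}"
            "\<not> connected (with_proj (delete_edges H F))"
          using m by (auto simp: undirected_edges_def)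
        ultimately show False
          using edge_deletion_connected[OF fin R d_less vertex F(2)] connected_delete_edges_iff[OF R(2,1), of F]
            \<open>?V \<noteq> {}\<close> by auto
      qed
      let ?F = "(\<lambda>u. {v, u}) ` (?R `` {v})"
      have F: "card ?F = ?d"
        using v(2) by (subst card_image) (auto simp: inj_on_def doubleton_eq_iff)
      have "?F \<subseteq> undirected_edges H"
        by (auto simp: undirected_edges_def)
      moreover have "\<not> connected (with_proj (delete_edges H ?F))"
      proof -
        have "\<not> ?V \<subseteq> {v}"
          using assms(2) card_mono[of "{v}" ?V] by auto
        then obtain w where w: "w \<in> ?V" "w \<noteq> v"
          by blast
        have "(v, w) \<notin> {(a, b) \<in> ?R. {a, b} \<notin> ?F}\<^sup>*"
          using w(2) by (auto elim: converse_rtranclE)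
        then show ?thesis
          using w v R by (auto simp: connected_delete_edges_iff)
      qed
      ultimately show "?d \<in> ?M"
        unfolding F[symmetric] by blast
    qed
    then show ?thesis
      using assms(2) by (simp add: edge_connectivity_def)
  qed
qed

section \<open>Token graphs of trees\<close>

lemma closed_vertex_walk_arcs:
  assumes "ys \<noteq> []"
  shows "pcas (hd ys) (vwalk_arcs ys) (last ys)" "pawalk_verts (hd ys) (vwalk_arcs ys) = ys"
  using assms by (induction ys rule: vwalk_arcs.induct) simp_all

lemma set_vwalk_arcs_iff_successively:
  "set (vwalk_arcs ys) \<subseteq> E \<longleftrightarrow> successively (\<lambda>x y. (x, y) \<in> E) ys"
  by (induction ys rule: vwalk_arcs.induct) auto

text \<open>A path closed by an edge becomes a cycle in the arc-list sense by repeating its first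
  vertex at the end; the arcs are then as many as the vertices of the path.\<close>

lemma finite_tree_of_undirected_tree:
  assumes "undirected_tree G"
  shows "finite_tree (pverts G) (parcs G)"
proof -
  interpret pair_graph G
    using assms by (simp add: undirected_tree_def)
  have arcs: "parcs G \<subseteq> pverts G \<times> pverts G" "sym (parcs G)"
    by (auto intro: symI arcs_symmetric dest: in_arcsD1 in_arcsD2)
  show ?thesis
  proof
    show "(x, y) \<in> (parcs G)\<^sup>*" if "x \<in> pverts G" "y \<in> pverts G" for x y
      using assms that connected_with_proj_iff[OF arcs(2,1)] by (auto simp: undirected_tree_def)
    show "(last xs, hd xs) \<notin> parcs G" if "simple_path (parcs G) xs" "3 \<le> length xs" for xs
    proof
      assume closing: "(last xs, hd xs) \<in> parcs G"
      let ?ys = "xs @ [hd xs]"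
      let ?p = "vwalk_arcs ?ys"
      have "xs \<noteq> []"
        using that(2) by auto
      then have "set ?p \<subseteq> parcs G"
        unfolding set_vwalk_arcs_iff_successively using that closing
        by (simp add: successively_append_iff simple_path_def)
      moreover have "hd xs \<in> pverts G"
        using closing arcs by auto
      moreover have "length ?p = length xs"
        using vwalk_length_simp[of ?ys] unfolding vwalk_length_def by simp
      moreover have "distinct (tl ?ys)"
        using that(1) \<open>xs \<noteq> []\<close> by (cases xs) (auto simp: simple_path_def)
      ultimately have "cycle ?p \<and> 3 \<le> length ?p"
        using closed_vertex_walk_arcs[of ?ys] that(2) \<open>xs \<noteq> []\<close>
        by (auto simp: cycle_def awalk_def intro!: exI[of _ "hd xs"])
      then show False
        using assms by (auto simp: undirected_tree_def)
    qed
  qed (use pair_finite_verts arcs no_loops' in \<open>auto intro: arcs_symmetric\<close>)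
qed

section \<open>Token moves as adjacency in the token graph\<close>

context finite_tree
begin

text \<open>Equal cardinalities split the symmetric difference evenly, so one end of the edge is
  vacated and the other newly occupied; symmetry of \<open>E\<close> provides the right
  orientation.\<close>

lemma token_moves_iff_sym_diff:
  assumes "A \<subseteq> V" "card A = k" "B \<subseteq> V" "card B = k"
  shows "(A, B) \<in> token_moves E \<longleftrightarrow> (\<exists>(a, b) \<in> E. sym_diff A B = {a, b})"
proof
  assume "(A, B) \<in> token_moves E"
  then obtain a b where "(a, b) \<in> E" "a \<in> A" "b \<notin> A" "B = insert b (A - {a})"
    by (rule token_movesE)
  then show "\<exists>(a, b) \<in> E. sym_diff A B = {a, b}"
    by (intro bexI[of _ "(a, b)"]) auto
next
  assume "\<exists>(a, b) \<in> E. sym_diff A B = {a, b}"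
  then obtain a b where ab: "(a, b) \<in> E" "sym_diff A B = {a, b}"
    by blast
  have fin: "finite A" "finite B"
    using assms finite_verts finite_subset by blast+
  have "card (A - B) = card (B - A)"
    using assms(2,4) fin by (metis card_Diff_subset_Int card_mono finite_Int inf_commute inf_le1)
  then have "A - B = {} \<longleftrightarrow> B - A = {}"
    using fin by (metis card_0_eq finite_Diff)
  moreover have "sym_diff A B \<noteq> {}"
    unfolding ab(2) by simp
  ultimately obtain x y where xy: "x \<in> A" "x \<notin> B" "y \<in> B" "y \<notin> A"
    by blast
  then have "x \<in> {a, b}" "y \<in> {a, b}" "x \<noteq> y"
    unfolding ab(2)[symmetric] by auto
  then have "{a, b} = {x, y}" "(x, y) \<in> E"
    using ab(1) edges_sym by auto
  have only: "z = x \<or> z = y" if "(z \<in> A) \<noteq> (z \<in> B)" for z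
  proof -
    have "z \<in> sym_diff A B"
      using that by blast
    then show ?thesis
      unfolding ab(2) \<open>{a, b} = {x, y}\<close> by simp
  qed
  have "B = insert y (A - {x})"
    using only xy by blast
  then show "(A, B) \<in> token_moves E"
    using token_movesI[OF \<open>(x, y) \<in> E\<close> xy(1,4)] by simp
qed

lemma card_token_moves_Image: "card (token_moves E `` {A}) = card (boundary E A)"
proof -
  let ?f = "\<lambda>(a, b). insert b (A - {a})"
  have "inj_on ?f (boundary E A)"
  proof (rule inj_on_inverseI)
    fix e assume "e \<in> boundary E A"
    then obtain a b where ab: "e = (a, b)" "a \<in> A" "b \<notin> A"
      by (cases e) (simp add: boundary_def)
    then have "A - insert b (A - {a}) = {a}" "insert b (A - {a}) - A = {b}"
      by auto
    then show "(the_elem (A - ?f e), the_elem (?f e - A)) = e"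
      using ab(1) by simp
  qed
  moreover have "token_moves E `` {A} = ?f ` boundary E A"
    by (auto simp: token_moves_def image_iff)
  ultimately show ?thesis
    by (simp add: card_image)
qed

end

theorem theorem1:
  fixes G :: "'a pair_pre_digraph" and n k :: nat
  assumes "undirected_tree G"
    and "card (pverts G) = n"
    and "n \<ge> 2"
    and "1 \<le> k" and "k \<le> n - 1"
  shows "vertex_connectivity (token_graph k G) = edge_connectivity (token_graph k G)
    \<and> edge_connectivity (token_graph k G) = min_degree (token_graph k G)"
proof -
  let ?H = "token_graph k G" and ?V = "pverts G" and ?E = "parcs G"
  interpret finite_tree ?V ?E
    using assms(1) by (rule finite_tree_of_undirected_tree)
  have H: "pair_graph ?H"
    using assms(1) by (intro pair_graph_token_graph) (simp add: undirected_tree_def)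
  have verts: "pverts ?H = {A. A \<subseteq> ?V \<and> card A = k}"
    by (simp add: token_graph_def)
  have arcs: "(A, B) \<in> parcs ?H \<longleftrightarrow> A \<in> pverts ?H \<and> (A, B) \<in> token_moves ?E" for A B
  proof (cases "A \<in> pverts ?H \<and> B \<in> pverts ?H")
    case True
    then show ?thesis
      using token_moves_iff_sym_diff[of A k B] by (simp add: token_graph_def)
  next
    case False
    then show ?thesis
      using token_moves_k_subset[of A B k] unfolding verts by (auto simp: token_graph_def)
  qed
  have finH: "finite (pverts ?H)"
    unfolding verts using finite_verts by simp
  have "k \<le> card ?V"
    using assms(2,5) by simp
  then obtain A where A: "A \<subseteq> ?V" "card A = k"
    by (rule obtain_subset_with_card_n)
  then have "A \<noteq> {}" "A \<noteq> ?V"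
    using assms(2-5) by auto
  then obtain a b where ab: "(a, b) \<in> ?E" "a \<in> A" "b \<notin> A"
    using boundary_nonempty[OF A(1)] by auto
  \<comment> \<open>A configuration and one of its moves give two vertices, so the default value 0
    of \<open>edge_connectivity\<close> does not arise.\<close>
  have "{A, insert b (A - {a})} \<subseteq> pverts ?H"
    using token_moves_k_subset[OF token_movesI[OF ab]] A by (auto simp: verts)
  moreover have "A \<noteq> insert b (A - {a})"
    using ab by blast
  then have "card {A, insert b (A - {a})} = 2"
    by simp
  ultimately have two: "2 \<le> card (pverts ?H)"
    using card_mono[OF finH] by metis
  have degree: "min_degree ?H \<le> card (boundary ?E A)" if "A \<in> pverts ?H" for A
  proof -
    have "parcs ?H `` {A} = token_moves ?E `` {A}"
      using arcs that by auto
    then show ?thesis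
      unfolding min_degree_def using that finH
      by (intro Min_le image_eqI[of _ _ A]) (auto simp: out_degree_with_proj card_token_moves_Image)
  qed
  have "(A, B) \<in> (Restr (parcs ?H) (pverts ?H - S))\<^sup>*"
    if S: "S \<subseteq> pverts ?H" "card S < min_degree ?H" and AB: "A \<in> pverts ?H - S" "B \<in> pverts ?H - S"
    for S A B
  proof -
    have "(A, B) \<in> (Restr (token_moves ?E) (- S))\<^sup>*"
    proof (rule token_moves_connected)
      show "S = {} \<or> (\<forall>A. A \<subseteq> ?V \<longrightarrow> card A = k \<longrightarrow> card S < card (boundary ?E A))"
        using degree S(2) by (auto simp: verts intro: less_le_trans)
    qed (use AB S finH finite_tree_axioms in \<open>auto simp: verts intro: finite_subset\<close>)
    \<comment> \<open>\<open>token_moves\<close> does not confine its walks to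
      \<open>k\<close>-subsets, so membership is carried along the walk.\<close>
    then have "B \<in> pverts ?H \<and> (A, B) \<in> (Restr (parcs ?H) (pverts ?H - S))\<^sup>*"
    proof (induction rule: rtrancl_induct)
      case (step Y Z)
      then have "Z \<in> pverts ?H"
        using token_moves_k_subset[of Y Z k] by (auto simp: verts)
      then show ?case
        using step arcs[of Y Z] by (auto intro: rtrancl_into_rtrancl)
    qed (use AB in simp)
    then show ?thesis ..
  qed
  then show ?thesis
    using connectivity_eq_min_degree[OF H two] by simp
qed

end
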